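(* Let $(W,\wp)$ be a partial $S_b$-metric space. Then the partial $S_b$-metric topological space $(W,\tau_{S_b})$ is a $T_0$ space.
   Context: Partial $S_b$-metric space: let $W$ be a nonempty set. A map $\wp: W\times W\times W\to[0,\infty)$ is a partial $S_b$-metric with coefficient $t\ge 1$ on $W$ if for all $p,q,r,s\in W$: (1) $p=q=r$ if and only if $\wp(p,q,r)=\wp(p,p,p)=\wp(q,q,q)=\wp(r,r,r)$; (2) $\wp(p,p,p)\le \wp(p,q,r)$; (3) $\wp(p,p,q)=\wp(q,q,p)$; (4) $\wp(p,q,r)\le t\big(\wp(p,p,s)+\wp(q,q,s)+\wp(r,r,s)\big)-\wp(s,s,s)$. The pair $(W,\wp)$ is then called a partial $S_b$-metric space (with coefficient $t$). Balls: for $p\in W$ and $r>0$, $D(p;r)=\{z\in W:\ \wp(p,p,z)<r+\wp(p,p,p)\}$. Topology: $\tau_{S_b}$ is the topology on $W$ generated by the collection $\mathscr{B}=\{D(x;r): x\in W,\ r>0\}$ taken as a basis, i.e. $\tau_{S_b}=\{\bigcup_\alpha B_\alpha : B_\alpha\in\mathscr{B}\}$. The space $(W,\tau_{S_b})$ is called the partial $S_b$-metric topological space. $T_0$: a topological space is $T_0$ if for each pair of distinct points there is an open set containing one of the points but not the other. *)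

theory Defs
  imports "HOL-Analysis.Analysis"
begin

text \<open>A chain \<open>a = b = c = d\<close> of equalities is rendered as a conjunction. All axioms are relative
  to the carrier \<open>W\<close>; the values of \<open>\<rho>\<close> off \<open>W\<close> are irrelevant.\<close>

locale partial_Sb_metric_space =
  fixes W :: "'a set" and \<rho> :: "'a \<Rightarrow> 'a \<Rightarrow> 'a \<Rightarrow> real" and t :: real
  assumes nonempty: "W \<noteq> {}"
    and coeff_ge_1: "t \<ge> 1"
    and nonneg: "\<lbrakk>p \<in> W; q \<in> W; r \<in> W\<rbrakk> \<Longrightarrow> 0 \<le> \<rho> p q r"
    and eq_iff: "\<lbrakk>p \<in> W; q \<in> W; r \<in> W\<rbrakk> \<Longrightarrow>
      (p = q \<and> q = r) \<longleftrightarrow> (\<rho> p q r = \<rho> p p p \<and> \<rho> p p p = \<rho> q q q \<and> \<rho> q q q = \<rho> r r r)"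
    and self_le: "\<lbrakk>p \<in> W; q \<in> W; r \<in> W\<rbrakk> \<Longrightarrow> \<rho> p p p \<le> \<rho> p q r"
    and sym: "\<lbrakk>p \<in> W; q \<in> W\<rbrakk> \<Longrightarrow> \<rho> p p q = \<rho> q q p"
    and triangle: "\<lbrakk>p \<in> W; q \<in> W; r \<in> W; s \<in> W\<rbrakk> \<Longrightarrow>
      \<rho> p q r \<le> t * (\<rho> p p s + \<rho> q q s + \<rho> r r s) - \<rho> s s s"

definition Sb_ball :: "'a set \<Rightarrow> ('a \<Rightarrow> 'a \<Rightarrow> 'a \<Rightarrow> real) \<Rightarrow> 'a \<Rightarrow> real \<Rightarrow> 'a set" where
  "Sb_ball W \<rho> p r = {z \<in> W. \<rho> p p z < r + \<rho> p p p}"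

definition Sb_balls :: "'a set \<Rightarrow> ('a \<Rightarrow> 'a \<Rightarrow> 'a \<Rightarrow> real) \<Rightarrow> 'a set set" where
  "Sb_balls W \<rho> = {Sb_ball W \<rho> x r | x r. x \<in> W \<and> r > 0}"

definition Sb_ball_unions :: "'a set \<Rightarrow> ('a \<Rightarrow> 'a \<Rightarrow> 'a \<Rightarrow> real) \<Rightarrow> 'a set set" where
  "Sb_ball_unions W \<rho> = {\<Union>\<B> | \<B>. \<B> \<subseteq> Sb_balls W \<rho>}"

text \<open>The axioms do not force the balls to be a basis: the union family above need not be closed
  under binary intersections. Take points \<open>x, z, w\<^sub>n\<close> (\<open>n \<ge> 1\<close>) with the b-metric \<open>d x z = 1\<close>,
  \<open>d x w\<^sub>n = 2\<close>, \<open>d z w\<^sub>n = 1/n\<close>, \<open>d w\<^sub>n w\<^sub>m = 1/n + 1/m\<close> (\<open>n \<noteq> m\<close>), and \<open>\<rho> p q r = d p r + d q r\<close>,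
  \<open>t = 2\<close>; the balls of radius 3 around \<open>x\<close> and of radius 1 around \<open>z\<close> meet in \<open>{z}\<close>, which is not a
  union of balls. The topology is therefore the one generated by the balls; whenever the union
  family is a topology, the two agree, see \<open>openin_Sb_topology_iff\<close> below.\<close>

definition Sb_topology :: "'a set \<Rightarrow> ('a \<Rightarrow> 'a \<Rightarrow> 'a \<Rightarrow> real) \<Rightarrow> 'a topology" where
  "Sb_topology W \<rho> = topology_generated_by (Sb_balls W \<rho>)"

lemma topspace_Sb_topology: "topspace (Sb_topology W \<rho>) = W"
proof -
  have "x \<in> Sb_ball W \<rho> x 1" if "x \<in> W" for x
    using that by (simp add: Sb_ball_def)
  then have "W \<subseteq> \<Union>(Sb_balls W \<rho>)"
    unfolding Sb_balls_def using zero_less_one by blast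
  moreover have "\<Union>(Sb_balls W \<rho>) \<subseteq> W"
    by (auto simp: Sb_balls_def Sb_ball_def)
  ultimately show ?thesis
    unfolding Sb_topology_def topology_generated_by_topspace by blast
qed

lemma openin_Sb_topology_if_union: "U \<in> Sb_ball_unions W \<rho> \<Longrightarrow> openin (Sb_topology W \<rho>) U"
  unfolding Sb_ball_unions_def Sb_topology_def
  by (clarsimp, rule openin_Union) (auto intro: topology_generated_by_Basis)

lemma openin_Sb_topology_iff:
  assumes "istopology (\<lambda>U. U \<in> Sb_ball_unions W \<rho>)"
  shows "openin (Sb_topology W \<rho>) U \<longleftrightarrow> U \<in> Sb_ball_unions W \<rho>"
proof
  have eq: "openin (topology (\<lambda>U. U \<in> Sb_ball_unions W \<rho>)) = (\<lambda>U. U \<in> Sb_ball_unions W \<rho>)"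
    using assms by (rule topology_inverse')
  have "B \<in> Sb_ball_unions W \<rho>" if "B \<in> Sb_balls W \<rho>" for B
    unfolding Sb_ball_unions_def using that by (auto intro!: exI[of _ "{B}"])
  moreover assume "openin (Sb_topology W \<rho>) U"
  ultimately have "openin (topology (\<lambda>U. U \<in> Sb_ball_unions W \<rho>)) U"
    unfolding Sb_topology_def openin_topology_generated_by_iff
    by (auto simp: eq elim: generate_topology_on_coarsest[rotated 2, OF _ assms])
  then show "U \<in> Sb_ball_unions W \<rho>"
    by (simp add: eq)
qed (rule openin_Sb_topology_if_union)

end

theory Submission
  imports Defs
begin

text \<open>For \<open>p \<noteq> q\<close>, the axioms rule out \<open>\<rho> p p q = \<rho> p p p = \<rho> q q q\<close>. As \<open>\<rho> p p q = \<rho> q q p\<close> is at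
  least both self-distances, it strictly exceeds one of them, say \<open>\<rho> p p p\<close>, and then the ball
  around \<open>p\<close> whose radius is the difference contains \<open>p\<close> but not \<open>q\<close>. A single ball thus separates
  the points, both in the generated topology and in the family of unions of balls.\<close>

lemma Sb_ball_in_unions:
  assumes "x \<in> W" "r > 0"
  shows "Sb_ball W \<rho> x r \<in> Sb_ball_unions W \<rho>"
  unfolding Sb_ball_unions_def Sb_balls_def
  using assms by (auto intro!: exI[of _ "{Sb_ball W \<rho> x r}"])

lemma Sb_ball_separates:
  assumes "p \<in> W" "\<rho> p p p < \<rho> p p q"
  shows "\<exists>U\<in>Sb_ball_unions W \<rho>. p \<in> U \<and> q \<notin> U"
proof
  let ?U = "Sb_ball W \<rho> p (\<rho> p p q - \<rho> p p p)"
  show "?U \<in> Sb_ball_unions W \<rho>"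
    using assms by (intro Sb_ball_in_unions) auto
  show "p \<in> ?U \<and> q \<notin> ?U"
    using assms by (simp add: Sb_ball_def)
qed

lemma (in partial_Sb_metric_space) self_less_cases:
  assumes "p \<in> W" "q \<in> W" "p \<noteq> q"
  shows "\<rho> p p p < \<rho> p p q \<or> \<rho> q q q < \<rho> q q p"
proof -
  have "\<rho> p p p \<le> \<rho> p p q" "\<rho> q q q \<le> \<rho> q q p" "\<rho> p p q = \<rho> q q p"
    using self_le[of p p q] self_le[of q q p] sym[of p q] assms by blast+
  moreover have "\<not> (\<rho> p p q = \<rho> p p p \<and> \<rho> p p p = \<rho> q q q)"
    using assms eq_iff[of p p q] by auto
  ultimately show ?thesis
    by linarith
qed

theorem theorem2p10:
  fixes W :: "'a set" and \<rho> :: "'a \<Rightarrow> 'a \<Rightarrow> 'a \<Rightarrow> real" and t :: real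
  assumes "partial_Sb_metric_space W \<rho> t"
  shows "t0_space (Sb_topology W \<rho>) \<and>
    (\<forall>p\<in>W. \<forall>q\<in>W. p \<noteq> q \<longrightarrow> (\<exists>U\<in>Sb_ball_unions W \<rho>. p \<notin> U \<longleftrightarrow> q \<in> U))"
proof -
  have sep: "\<exists>U\<in>Sb_ball_unions W \<rho>. p \<notin> U \<longleftrightarrow> q \<in> U"
    if "p \<in> W" "q \<in> W" "p \<noteq> q" for p q
    using partial_Sb_metric_space.self_less_cases[OF assms that]
  proof
    assume "\<rho> p p p < \<rho> p p q"
    from Sb_ball_separates[of p W \<rho>, OF \<open>p \<in> W\<close> this] show ?thesis by blast
  next
    assume "\<rho> q q q < \<rho> q q p"
    from Sb_ball_separates[of q W \<rho>, OF \<open>q \<in> W\<close> this] show ?thesis by blast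
  qed
  moreover have "t0_space (Sb_topology W \<rho>)"
    unfolding t0_space_def topspace_Sb_topology
    using sep openin_Sb_topology_if_union by metis
  ultimately show ?thesis by blast
qed

end
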